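(* Let $0\le K\le N$ and $1\le T\le 2^N$ be integers. For an ORB-type GRAND algorithm with ordered list of distinct error patterns $\underline{e}(1),\dots,\underline{e}(T)$ and permutation law $\pi_{\underline{y}}$, the average number of tests $Q$ conducted by the codeword tester over the random code ensemble is $$Q=T-\sum_{t=1}^{T}f(t)-\sum_{t=1}^{T-1}p_t\left(T-t-\sum_{i=t+1}^{T}f(i)\right).$$
   Context: Channel: $q_0,q_1$ are probability densities on $\mathbb{R}$; when $\underline{w}\in\mathbb{F}_2^N$ is sent, the output $\underline{Y}\in\mathbb{R}^N$ has density $\prod_i q_{w_i}(y_i)$. The log-likelihood ratios are $\ell_i=\log(q_0(y_i)/q_1(y_i))$ and the hard decision is $\theta(\underline{y})\in\mathbb{F}_2^N$ with $\theta(\underline y)_i=\mathbf{1}(\ell_i<0)$. ORB-type GRAND: an ordered list of $T$ distinct vectors $\underline{e}(1),\dots,\underline{e}(T)\in\mathbb{F}_2^N$ (error patterns) is fixed in advance, independent of $\underline{Y}$; a permutation law assigns (measurably) to each $\underline{y}\in\mathbb{R}^N$ a permutation $\pi_{\underline{y}}$ of the coordinates $\{1,\dots,N\}$, acting on vectors of $\mathbb{F}_2^N$ by permuting coordinates. Given $\underline{y}$ and a codebook $\mathcal{C}$, the decoder tests for $t=1,2,\dots,T$ whether $\theta(\underline{y})\oplus\pi_{\underline{y}}(\underline{e}(t))\in\mathcal{C}$; it stops at the first $t$ for which this holds and outputs that codeword; if no $t\le T$ works, it stops after $T$ tests and declares failure. The number of tests is the value of $t$ at which it stops. Random code ensemble: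 the codewords $\underline{W}(1),\dots,\underline{W}(2^K)$ are drawn sequentially, uniformly without replacement, from $\mathbb{F}_2^N$; the transmitted message index is uniform on $\{1,\dots,2^K\}$ and independent of the codebook, and given the codebook and index the output $\underline{Y}$ depends only on the transmitted codeword. $Q$ is the expectation over codebook, message and channel. $p_t=\mathbf{E}_{\underline{Y}}[P_{\underline{W}|\underline{Y}}(\theta(\underline{Y})\oplus\pi_{\underline{Y}}(\underline{e}(t))\mid\underline{Y})]$, where $\underline{W}$ is the transmitted codeword (uniform on $\mathbb{F}_2^N$ after averaging over the ensemble) and $P_{\underline{W}|\underline{Y}}$ is the ensemble-averaged posterior. The pre-target codeword-hit probability is $f(t)=1-\prod_{i=1}^{t-1}\frac{2^N-2^K+1-i}{2^N-i}$ (so $f(1)=0$). *)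

theory Defs
  imports "HOL-Probability.Probability" "HOL-Library.Z2"
begin

definition words :: "nat \<Rightarrow> (nat \<Rightarrow> bit) set" where
  "words N = {1..N} \<rightarrow>\<^sub>E UNIV"

definition add_word :: "nat \<Rightarrow> (nat \<Rightarrow> bit) \<Rightarrow> (nat \<Rightarrow> bit) \<Rightarrow> nat \<Rightarrow> bit" where
  "add_word N u v = (\<lambda>i\<in>{1..N}. u i + v i)"

text \<open>Coordinate \<open>i\<close> of the permuted word is coordinate \<open>\<sigma> i\<close> of \<open>v\<close>; the other convention
  amounts to replacing the permutation by its inverse.\<close>

definition permute_word :: "nat \<Rightarrow> (nat \<Rightarrow> nat) \<Rightarrow> (nat \<Rightarrow> bit) \<Rightarrow> nat \<Rightarrow> bit" where
  "permute_word N \<sigma> v = (\<lambda>i\<in>{1..N}. v (\<sigma> i))"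

abbreviation outputs :: "nat \<Rightarrow> (nat \<Rightarrow> real) measure" where
  "outputs N \<equiv> PiM {1..N} (\<lambda>_. borel)"

definition is_density :: "(real \<Rightarrow> real) \<Rightarrow> bool" where
  "is_density g \<longleftrightarrow> g \<in> borel_measurable borel \<and> (\<forall>x. 0 \<le> g x) \<and>
     (\<integral>\<^sup>+ x. ennreal (g x) \<partial>lborel) = 1"

text \<open>The channel is given by \<open>q\<close>, where \<open>q 0\<close> and \<open>q 1\<close> are the two transition densities.\<close>

definition channel :: "(bit \<Rightarrow> real \<Rightarrow> real) \<Rightarrow> nat \<Rightarrow> (nat \<Rightarrow> bit) \<Rightarrow> (nat \<Rightarrow> real) measure" where
  "channel q N w =
     density (PiM {1..N} (\<lambda>_. lborel)) (\<lambda>y. ennreal (\<Prod>i\<in>{1..N}. q (w i) (y i)))"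

text \<open>Since \<open>ln 0 = 0\<close> in HOL, the values \<open>\<plusminus>\<infinity>\<close> of the log-likelihood ratio are given
  explicitly. The value for \<open>0/0\<close> is immaterial: such outputs have probability zero.\<close>

definition llr :: "(bit \<Rightarrow> real \<Rightarrow> real) \<Rightarrow> real \<Rightarrow> ereal" where
  "llr q x = (if q 0 x = 0 \<and> q 1 x = 0 then 0
              else if q 1 x = 0 then \<infinity>
              else if q 0 x = 0 then - \<infinity>
              else ereal (ln (q 0 x / q 1 x)))"

definition hard_decision :: "(bit \<Rightarrow> real \<Rightarrow> real) \<Rightarrow> nat \<Rightarrow> (nat \<Rightarrow> real) \<Rightarrow> nat \<Rightarrow> bit" where
  "hard_decision q N y = (\<lambda>i\<in>{1..N}. if llr q (y i) < 0 then 1 else 0)"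

text \<open>The word tested at step \<open>t\<close>, for permutation law \<open>\<pi>\<close> and error patterns \<open>e 1, e 2, \<dots>\<close>\<close>

definition candidate ::
  "(bit \<Rightarrow> real \<Rightarrow> real) \<Rightarrow> nat \<Rightarrow> ((nat \<Rightarrow> real) \<Rightarrow> nat \<Rightarrow> nat) \<Rightarrow> (nat \<Rightarrow> nat \<Rightarrow> bit) \<Rightarrow>
     nat \<Rightarrow> (nat \<Rightarrow> real) \<Rightarrow> nat \<Rightarrow> bit" where
  "candidate q N \<pi> e t y = add_word N (hard_decision q N y) (permute_word N (\<pi> y) (e t))"

definition num_tests ::
  "(bit \<Rightarrow> real \<Rightarrow> real) \<Rightarrow> nat \<Rightarrow> nat \<Rightarrow> ((nat \<Rightarrow> real) \<Rightarrow> nat \<Rightarrow> nat) \<Rightarrow>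
     (nat \<Rightarrow> nat \<Rightarrow> bit) \<Rightarrow> (nat \<Rightarrow> bit) set \<Rightarrow> (nat \<Rightarrow> real) \<Rightarrow> nat" where
  "num_tests q N T \<pi> e C y =
     (if \<exists>t\<in>{1..T}. candidate q N \<pi> e t y \<in> C
      then (LEAST t. t \<in> {1..T} \<and> candidate q N \<pi> e t y \<in> C)
      else T)"

primrec draw_codewords :: "nat \<Rightarrow> nat \<Rightarrow> (nat \<Rightarrow> bit) list pmf" where
  "draw_codewords N 0 = return_pmf []"
| "draw_codewords N (Suc m) =
     bind_pmf (draw_codewords N m)
       (\<lambda>ws. map_pmf (\<lambda>w. ws @ [w]) (pmf_of_set (words N - set ws)))"

text \<open>An outcome of the ensemble is \<open>((ws, m), y)\<close>: the list \<open>ws\<close> of \<open>2 ^ K\<close> codewords, the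
  (zero-based) message index \<open>m\<close>, and the channel output \<open>y\<close>.\<close>

type_synonym outcome = "((nat \<Rightarrow> bit) list \<times> nat) \<times> (nat \<Rightarrow> real)"

definition codebook :: "outcome \<Rightarrow> (nat \<Rightarrow> bit) set" where
  "codebook \<omega> = set (fst (fst \<omega>))"

definition sent :: "outcome \<Rightarrow> nat \<Rightarrow> bit" where
  "sent \<omega> = fst (fst \<omega>) ! snd (fst \<omega>)"

definition received :: "outcome \<Rightarrow> nat \<Rightarrow> real" where
  "received \<omega> = snd \<omega>"

definition ensemble :: "(bit \<Rightarrow> real \<Rightarrow> real) \<Rightarrow> nat \<Rightarrow> nat \<Rightarrow> outcome measure" where
  "ensemble q N K =
     measure_pmf (pair_pmf (draw_codewords N (2 ^ K)) (pmf_of_set {..<2 ^ K})) \<bind>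
       (\<lambda>c. distr (channel q N (fst c ! snd c)) (count_space UNIV \<Otimes>\<^sub>M outputs N) (\<lambda>y. (c, y)))"

definition avg_tests ::
  "(bit \<Rightarrow> real \<Rightarrow> real) \<Rightarrow> nat \<Rightarrow> nat \<Rightarrow> nat \<Rightarrow> ((nat \<Rightarrow> real) \<Rightarrow> nat \<Rightarrow> nat) \<Rightarrow>
     (nat \<Rightarrow> nat \<Rightarrow> bit) \<Rightarrow> real" where
  "avg_tests q N K T \<pi> e =
     (\<integral>\<omega>. real (num_tests q N T \<pi> e (codebook \<omega>) (received \<omega>)) \<partial>ensemble q N K)"

text \<open>\<open>posterior q N K w\<close> is the conditional probability that \<open>w\<close> was sent given the output
  alone (with the codebook averaged out), as a function of the outcome measurable with respect
  to the sigma-algebra generated by the output.\<close>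

definition output_algebra :: "(bit \<Rightarrow> real \<Rightarrow> real) \<Rightarrow> nat \<Rightarrow> nat \<Rightarrow> outcome measure" where
  "output_algebra q N K = vimage_algebra (space (ensemble q N K)) received (outputs N)"

definition posterior ::
  "(bit \<Rightarrow> real \<Rightarrow> real) \<Rightarrow> nat \<Rightarrow> nat \<Rightarrow> (nat \<Rightarrow> bit) \<Rightarrow> outcome \<Rightarrow> real" where
  "posterior q N K w =
     real_cond_exp (ensemble q N K) (output_algebra q N K) (indicator {\<omega>. sent \<omega> = w})"

definition p_hit ::
  "(bit \<Rightarrow> real \<Rightarrow> real) \<Rightarrow> nat \<Rightarrow> nat \<Rightarrow> ((nat \<Rightarrow> real) \<Rightarrow> nat \<Rightarrow> nat) \<Rightarrow>
     (nat \<Rightarrow> nat \<Rightarrow> bit) \<Rightarrow> nat \<Rightarrow> real" where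
  "p_hit q N K \<pi> e t =
     (\<integral>\<omega>. posterior q N K (candidate q N \<pi> e t (received \<omega>)) \<omega> \<partial>ensemble q N K)"

definition pre_target_hit :: "nat \<Rightarrow> nat \<Rightarrow> nat \<Rightarrow> real" where
  "pre_target_hit N K t =
     1 - (\<Prod>i\<in>{1..<t}. (2 ^ N - 2 ^ K + 1 - real i) / (2 ^ N - real i))"

end

theory Submission
  imports Defs
begin

text \<open>The number of tests is at least \<open>t\<close> iff none of the first \<open>t - 1\<close> candidates is a
  codeword. Given the sent word and the output, these candidates are \<open>t - 1\<close> distinct words, and
  if the sent word is not among them, the other codewords avoid them with probability
  \<open>1 - f t\<close>, whatever the words are. Conditional expectation turns \<open>p_hit\<close> into
  the probability that the \<open>t\<close>-th candidate is the sent word, and these events are disjoint. Hence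
  the survival probability at \<open>t\<close> is \<open>(1 - f t) * (1 - (\<Sum>j<t. p j))\<close>, which is summed over \<open>t\<close>.\<close>

subsection \<open>Drawing codewords without replacement\<close>

lemma UNIV_bit: "(UNIV :: bit set) = {0, 1}"
  by (auto intro: bit.exhaust)

lemma finite_words [simp]: "finite (words N)"
  unfolding words_def by (intro finite_PiE) (simp_all add: UNIV_bit)

lemma card_words [simp]: "card (words N) = 2 ^ N"
  by (simp add: words_def card_PiE UNIV_bit numeral_2_eq_2)

text \<open>\<open>pmf_of_set\<close> is meaningful only on a nonempty finite set, so each draw
  needs a word that is still undrawn.\<close>

lemma undrawn_words_nonempty:
  assumes "length ws < 2 ^ N"
  shows "words N - set ws \<noteq> {}"
proof
  assume "words N - set ws = {}"
  then have "card (words N) \<le> card (set ws)"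
    by (intro card_mono) auto
  then show False
    using card_length[of ws] assms by simp
qed

lemma set_draw_codewords:
  assumes "m \<le> 2 ^ N" "ws \<in> set_pmf (draw_codewords N m)"
  shows "length ws = m \<and> distinct ws \<and> set ws \<subseteq> words N"
  using assms
proof (induction m arbitrary: ws)
  case 0
  then show ?case by simp
next
  case (Suc m)
  then obtain vs w where vs: "vs \<in> set_pmf (draw_codewords N m)"
    and w: "w \<in> set_pmf (pmf_of_set (words N - set vs))" and ws: "ws = vs @ [w]"
    by auto
  have *: "length vs = m \<and> distinct vs \<and> set vs \<subseteq> words N"
    using Suc vs by simp
  then have "words N - set vs \<noteq> {}"
    using Suc.prems by (intro undrawn_words_nonempty) simp
  then show ?case
    using * w ws by (simp add: set_pmf_of_set)
qed

lemma finite_set_draw_codewords: "m \<le> 2 ^ N \<Longrightarrow> finite (set_pmf (draw_codewords N m))"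
  by (rule finite_subset[OF _ finite_lists_length_eq[OF finite_words, of N m]])
     (auto dest: set_draw_codewords)

text \<open>If \<open>m\<close> distinct words avoiding \<open>S\<close> have been drawn, then
  \<open>2 ^ N - card S - m\<close> of the \<open>2 ^ N - m\<close> remaining words avoid
  \<open>S\<close>, so the conditional probability is the same for all such lists. Once the words
  outside \<open>S\<close> are exhausted, some factor is 0 and the sign of later factors is
  irrelevant.\<close>

lemma prob_draw_avoid:
  assumes "m \<le> 2 ^ N" "S \<subseteq> words N"
  shows "measure_pmf.prob (draw_codewords N m) {ws. S \<inter> set ws = {}} =
    (\<Prod>j<m. (2 ^ N - real (card S) - real j) / (2 ^ N - real j))"
  using assms(1)
proof (induction m)
  case 0
  then show ?case by simp
next
  case (Suc m)
  let ?D = "draw_codewords N m"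
  let ?c = "(2 ^ N - real (card S) - real m) / (2 ^ N - real m)"
  have "measure_pmf.prob (draw_codewords N (Suc m)) {ws. S \<inter> set ws = {}} =
      (\<integral>ws. measure_pmf.prob (map_pmf (\<lambda>w. ws @ [w]) (pmf_of_set (words N - set ws)))
        {ws. S \<inter> set ws = {}} \<partial>?D)"
    unfolding draw_codewords.simps measure_pmf_bind
    by (rule measure_pmf.measure_bind[where N = "count_space UNIV"])
      (simp_all add: measure_pmf_in_subprob_space)
  also have "\<dots> = (\<integral>ws. indicator {ws. S \<inter> set ws = {}} ws * ?c \<partial>?D)"
  proof (intro integral_cong_AE AE_pmfI)
    fix ws assume "ws \<in> set_pmf ?D"
    with Suc.prems have ws: "length ws = m" "distinct ws" "set ws \<subseteq> words N"
      using set_draw_codewords[of m N ws] by auto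
    have ne: "words N - set ws \<noteq> {}"
      using ws(1) Suc.prems by (intro undrawn_words_nonempty) simp
    have vimage: "(\<lambda>w. ws @ [w]) -` {ws. S \<inter> set ws = {}} =
        (if S \<inter> set ws = {} then - S else {})"
      by auto
    have cs: "card (set ws) = m"
      using ws by (simp add: distinct_card)
    have "real (card ((words N - set ws) \<inter> - S)) = 2 ^ N - real (card S) - real m"
      if disj: "S \<inter> set ws = {}"
    proof -
      have fS: "finite S"
        using assms(2) finite_words by (rule finite_subset)
      have "(words N - set ws) \<inter> - S = words N - (S \<union> set ws)"
        by auto
      moreover have "card (words N - (S \<union> set ws)) = 2 ^ N - card (S \<union> set ws)"
        using assms(2) ws(3) fS by (subst card_Diff_subset) auto
      moreover have "card (S \<union> set ws) = card S + m"
        using disj fS cs by (simp add: card_Un_disjoint)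
      \<comment> \<open>This bound makes the natural-number subtraction exact; it rests on the
        disjointness of \<open>S\<close> from the drawn words.\<close>
      moreover have "card (S \<union> set ws) \<le> 2 ^ N"
        using card_mono[OF finite_words, of "S \<union> set ws" N] assms(2) ws(3) by simp
      ultimately show ?thesis
        by (simp add: of_nat_diff)
    qed
    moreover have "real (card (words N - set ws)) = 2 ^ N - real m"
      using ws cs Suc.prems by (subst card_Diff_subset) (auto simp: of_nat_diff)
    ultimately show "measure_pmf.prob (map_pmf (\<lambda>w. ws @ [w]) (pmf_of_set (words N - set ws)))
        {ws. S \<inter> set ws = {}} = indicator {ws. S \<inter> set ws = {}} ws * ?c"
      using ne by (simp add: vimage measure_pmf_of_set indicator_def Compl_eq)
  qed simp_all
  also have "\<dots> = measure_pmf.prob ?D {ws. S \<inter> set ws = {}} * ?c"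
    by simp
  finally show ?case
    using Suc by simp
qed

text \<open>Each difference of products of length \<open>k + 1\<close> is \<open>k + 1\<close> times
  a product of length \<open>k\<close>, and the quotient of the latter two telescopes in
  \<open>s\<close>. For \<open>n = 2 ^ N\<close> and \<open>k + 1 = 2 ^ K\<close> the factor on the
  right is \<open>1 - pre_target_hit N K (Suc s)\<close>.\<close>

lemma falling_product_diff:
  fixes n :: real
  assumes "n > real s"
  shows "(\<Prod>j<Suc k. n - real s - real j) - (\<Prod>j<Suc k. n - real (Suc s) - real j) =
    (\<Prod>i\<in>{1..s}. (n - real k - real i) / (n - real i)) *
    ((\<Prod>j<Suc k. n - real j) - (\<Prod>j<Suc k. n - 1 - real j))"
proof -
  \<comment> \<open>The factor common to both products: they are \<open>a * E a\<close> and
    \<open>E a * (a - 1 - k)\<close>, so they differ by \<open>(k + 1) * E a\<close>.\<close>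
  define E where "E a = (\<Prod>j<k. a - 1 - real j)" for a
  have step: "(\<Prod>j<Suc k. a - real j) - (\<Prod>j<Suc k. a - 1 - real j) = real (Suc k) * E a" for a
  proof -
    have "(\<Prod>j<Suc k. a - real j) = a * E a"
      unfolding prod.lessThan_Suc_shift E_def by (simp add: algebra_simps)
    then show ?thesis
      by (simp add: E_def algebra_simps)
  qed
  have "E (n - real s) = (\<Prod>i\<in>{1..s}. (n - real k - real i) / (n - real i)) * E n"
    using assms
  proof (induction s)
    case (Suc s)
    \<comment> \<open>Both sides are the product of \<open>a - 1, ..., a - 1 - k\<close>, split at
      its first and at its last factor.\<close>
    have rec: "(a - 1) * E (a - 1) = E a * (a - 1 - real k)" for a
    proof -
      have "(\<Prod>j<Suc k. a - 1 - real j) = (a - 1) * E (a - 1)"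
        unfolding prod.lessThan_Suc_shift E_def by (simp add: algebra_simps)
      then show ?thesis
        by (simp add: E_def)
    qed
    have "E (n - real (Suc s)) =
        E (n - real s) * ((n - real k - real (Suc s)) / (n - real (Suc s)))"
      using rec[of "n - real s"] Suc.prems by (simp add: field_simps)
    with Suc show ?case by simp
  qed simp
  then show ?thesis
    using step[of "n - real s"] step[of n] by (simp add: algebra_simps)
qed

text \<open>Codewords are distinct, so averaging over the index is averaging over the words of the
  codebook. Summing over all words with an indicator then leaves expectations over the draw alone,
  one for each possible sent word.\<close>

lemma expectation_draw_index:
  fixes g :: "(nat \<Rightarrow> bit) list \<Rightarrow> real" and h :: "(nat \<Rightarrow> bit) \<Rightarrow> real"
  assumes "K \<le> N"
  shows "(\<integral>c. g (fst c) * h (fst c ! snd c)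
      \<partial>pair_pmf (draw_codewords N (2 ^ K)) (pmf_of_set {..<2 ^ K})) =
    (\<Sum>w\<in>words N. h w * (\<integral>ws. g ws * indicator {ws. w \<in> set ws} ws
      \<partial>draw_codewords N (2 ^ K))) / 2 ^ K"
proof -
  let ?D = "draw_codewords N (2 ^ K)"
  have le: "(2::nat) ^ K \<le> 2 ^ N"
    using assms by simp
  note fin = finite_set_draw_codewords[OF le]
  have ne: "{..<(2::nat) ^ K} \<noteq> {}"
    by (simp add: lessThan_empty_iff)
  have swap: "(\<Sum>m<2 ^ K. h (ws ! m)) = (\<Sum>w\<in>words N. h w * indicator {ws. w \<in> set ws} ws)"
    if "ws \<in> set_pmf ?D" for ws
  proof -
    have ws: "length ws = 2 ^ K" "distinct ws" "set ws \<subseteq> words N"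
      using set_draw_codewords[OF le that] by auto
    have "(\<Sum>m<2 ^ K. h (ws ! m)) = (\<Sum>w\<in>set ws. h w)"
      using bij_betw_nth[of ws "{..<2 ^ K}" "set ws"] ws
      by (intro sum.reindex_bij_betw) auto
    also have "\<dots> = (\<Sum>w\<in>words N. h w * indicator {ws. w \<in> set ws} ws)"
      using ws(3) by (intro sum.mono_neutral_cong_left) auto
    finally show ?thesis .
  qed
  have "(\<integral>c. g (fst c) * h (fst c ! snd c) \<partial>pair_pmf ?D (pmf_of_set {..<2 ^ K})) =
      (\<Sum>(ws, m)\<in>set_pmf ?D \<times> {..<2 ^ K}. pmf ?D ws / 2 ^ K * (g ws * h (ws ! m)))"
    using fin ne by (subst integral_measure_pmf[of "set_pmf ?D \<times> {..<2 ^ K}"])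
      (auto simp: pmf_pair pmf_of_set[OF ne] intro!: sum.cong)
  also have "\<dots> = (\<Sum>ws\<in>set_pmf ?D. pmf ?D ws * g ws * (\<Sum>m<2 ^ K. h (ws ! m))) / 2 ^ K"
    by (simp add: sum.cartesian_product[symmetric] sum_distrib_left sum_divide_distrib
        mult.assoc)
  also have "\<dots> = (\<Sum>ws\<in>set_pmf ?D. \<Sum>w\<in>words N.
      h w * (pmf ?D ws * (g ws * indicator {ws. w \<in> set ws} ws))) / 2 ^ K"
    by (intro arg_cong[where f = "\<lambda>x. x / 2 ^ K"] sum.cong refl)
      (simp only: swap sum_distrib_left mult_ac)
  also have "\<dots> = (\<Sum>w\<in>words N. h w * (\<Sum>ws\<in>set_pmf ?D.
      pmf ?D ws * (g ws * indicator {ws. w \<in> set ws} ws))) / 2 ^ K"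
    by (subst sum.swap) (simp add: sum_distrib_left)
  also have "\<dots> = (\<Sum>w\<in>words N. h w * (\<integral>ws. g ws * indicator {ws. w \<in> set ws} ws \<partial>?D)) / 2 ^ K"
    using fin by (subst integral_measure_pmf[of "set_pmf ?D"]) auto
  finally show ?thesis .
qed

text \<open>For a sent word \<open>w\<close> outside \<open>S\<close>, the probability that
  \<open>w\<close> is drawn and \<open>S\<close> avoided depends only on \<open>card S\<close>, and
  its ratio to the probability that \<open>w\<close> is drawn is the factor on the right. For
  \<open>w\<close> in \<open>S\<close> both sides contribute 0. The weight \<open>h\<close> will be
  the probability of an output event given the sent word.\<close>

lemma expectation_avoid:
  fixes h :: "(nat \<Rightarrow> bit) \<Rightarrow> real"
  assumes "K \<le> N" "S \<subseteq> words N" "card S < 2 ^ N"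
  defines "C \<equiv> pair_pmf (draw_codewords N (2 ^ K)) (pmf_of_set {..<2 ^ K})"
  shows "(\<integral>c. of_bool (S \<inter> set (fst c) = {}) * h (fst c ! snd c) \<partial>C) =
    (1 - pre_target_hit N K (Suc (card S))) *
      (\<integral>c. of_bool (fst c ! snd c \<notin> S) * h (fst c ! snd c) \<partial>C)"
proof -
  let ?D = "draw_codewords N (2 ^ K)"
  have le: "(2::nat) ^ K \<le> 2 ^ N"
    using assms(1) by simp
  \<comment> \<open>\<open>k\<close> counts the codewords other than the sent one.\<close>
  obtain k where k: "(2::nat) ^ K = Suc k"
    using not0_implies_Suc[of "2 ^ K"] by auto
  define d where "d = (\<Prod>j<Suc k. (2::real) ^ N - real j)"
  \<comment> \<open>\<open>G a / d\<close> is the probability that the whole draw avoids a fixed set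
    of \<open>a\<close> words.\<close>
  define G where "G a = (\<Prod>j<Suc k. (2::real) ^ N - real a - real j)" for a
  have avoid: "measure_pmf.prob ?D {ws. A \<inter> set ws = {}} = G (card A) / d" if "A \<subseteq> words N" for A
    using prob_draw_avoid[OF le that] unfolding k G_def d_def prod_dividef .
  have drawn: "(\<integral>ws. of_bool (A \<inter> set ws = {}) * indicator {ws. w \<in> set ws} ws \<partial>?D) =
      (G (card A) - G (Suc (card A))) / d" if A: "A \<subseteq> words N" and w: "w \<in> words N" "w \<notin> A" for A w
  proof -
    \<comment> \<open>Drawing \<open>w\<close> while avoiding \<open>A\<close> means avoiding
      \<open>A\<close> but not \<open>insert w A\<close>.\<close>
    have "(\<integral>ws. of_bool (A \<inter> set ws = {}) * indicator {ws. w \<in> set ws} ws \<partial>?D) =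
        (\<integral>ws. (indicator ({ws. A \<inter> set ws = {}} - {ws. insert w A \<inter> set ws = {}}) ws :: real) \<partial>?D)"
      by (intro Bochner_Integration.integral_cong) (auto simp: indicator_def)
    also have "\<dots> = measure_pmf.prob ?D ({ws. A \<inter> set ws = {}} - {ws. insert w A \<inter> set ws = {}})"
      by simp
    also have "\<dots> = measure_pmf.prob ?D {ws. A \<inter> set ws = {}} -
        measure_pmf.prob ?D {ws. insert w A \<inter> set ws = {}}"
      by (intro measure_pmf.finite_measure_Diff) auto
    also have "\<dots> = (G (card A) - G (Suc (card A))) / d"
      using avoid[of A] avoid[of "insert w A"] A w finite_subset[OF A]
      by (simp add: diff_divide_distrib)
    finally show ?thesis .
  qed
  have ratio: "G (card S) - G (Suc (card S)) =
      (1 - pre_target_hit N K (Suc (card S))) * (G 0 - G (Suc 0))"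
  proof -
    have kK: "(2::real) ^ K = real k + 1"
      using arg_cong[OF k, of real] by simp
    show ?thesis
      using falling_product_diff[of "card S" "2 ^ N" k] assms(3)
      unfolding G_def pre_target_hit_def atLeastLessThanSuc_atLeastAtMost kK
      by simp
  qed
  have "(\<integral>c. of_bool (S \<inter> set (fst c) = {}) * h (fst c ! snd c) \<partial>C) =
    (\<Sum>w\<in>words N. h w * (\<integral>ws. of_bool (S \<inter> set ws = {}) * indicator {ws. w \<in> set ws} ws \<partial>?D)) / 2 ^ K"
    unfolding C_def by (rule expectation_draw_index[OF assms(1)])
  also have "(\<Sum>w\<in>words N. h w * (\<integral>ws. of_bool (S \<inter> set ws = {}) * indicator {ws. w \<in> set ws} ws \<partial>?D)) =
    (\<Sum>w\<in>words N. (1 - pre_target_hit N K (Suc (card S))) *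
      (of_bool (w \<notin> S) * h w * (\<integral>ws. 1 * indicator {ws. w \<in> set ws} ws \<partial>?D)))"
  proof (intro sum.cong refl)
    fix w assume w: "w \<in> words N"
    show "h w * (\<integral>ws. of_bool (S \<inter> set ws = {}) * indicator {ws. w \<in> set ws} ws \<partial>?D) =
      (1 - pre_target_hit N K (Suc (card S))) *
        (of_bool (w \<notin> S) * h w * (\<integral>ws. 1 * indicator {ws. w \<in> set ws} ws \<partial>?D))"
    proof (cases "w \<in> S")
      case True
      then have "(\<lambda>ws. of_bool (S \<inter> set ws = {}) * indicator {ws. w \<in> set ws} ws) = (\<lambda>_. 0 :: real)"
        by (auto simp: indicator_def fun_eq_iff)
      then show ?thesis
        unfolding \<open>_ = (\<lambda>_. 0 :: real)\<close> using True by simp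
    next
      case False
      \<comment> \<open>The instance of \<open>drawn\<close> with the empty set gives the
        probability \<open>(G 0 - G 1) / d\<close> that \<open>w\<close> is drawn, to which
        \<open>ratio\<close> compares.\<close>
      then show ?thesis
        using drawn[OF assms(2) w False] drawn[of "{}" w] w ratio by simp
    qed
  qed
  also have "\<dots> / 2 ^ K = (1 - pre_target_hit N K (Suc (card S))) *
    ((\<Sum>w\<in>words N. of_bool (w \<notin> S) * h w * (\<integral>ws. 1 * indicator {ws. w \<in> set ws} ws \<partial>?D)) / 2 ^ K)"
    by (simp add: sum_distrib_left)
  \<comment> \<open>The literal factor 1 is the function \<open>g\<close> for which
    \<open>expectation_draw_index\<close> is read backwards.\<close>
  also have "(\<Sum>w\<in>words N. of_bool (w \<notin> S) * h w * (\<integral>ws. 1 * indicator {ws. w \<in> set ws} ws \<partial>?D)) / 2 ^ K =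
      (\<integral>c. 1 * (of_bool (fst c ! snd c \<notin> S) * h (fst c ! snd c)) \<partial>C)"
    unfolding C_def by (rule expectation_draw_index[OF assms(1), symmetric])
  finally show ?thesis by simp
qed

subsection \<open>Counting tests\<close>

text \<open>A number \<open>n\<close> in \<open>{1..T}\<close> equals the count of \<open>t\<close>
  in \<open>{1..T}\<close> with \<open>t \<le> n\<close>. Only the first \<open>T - 1\<close>
  candidates enter, since a hit at \<open>T\<close> and a failure both cost \<open>T\<close>
  tests.\<close>

lemma num_tests_eq_sum:
  assumes "1 \<le> T"
  shows "real (num_tests q N T \<pi> e C y) =
    (\<Sum>t=1..T. of_bool ((\<lambda>j. candidate q N \<pi> e j y) ` {1..t-1} \<inter> C = {}))"
proof -
  let ?hit = "\<lambda>t. candidate q N \<pi> e t y \<in> C"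
  let ?n = "num_tests q N T \<pi> e C y"
  have "?n \<in> {1..T} \<and> (\<forall>t\<in>{1..T}. (\<forall>j\<in>{1..t-1}. \<not> ?hit j) \<longleftrightarrow> t \<le> ?n)"
  proof (cases "\<exists>t\<in>{1..T}. ?hit t")
    case True
    define L where "L = (LEAST t. t \<in> {1..T} \<and> ?hit t)"
    have n: "?n = L"
      using True by (simp add: num_tests_def L_def)
    obtain t\<^sub>0 where t0: "t\<^sub>0 \<in> {1..T} \<and> ?hit t\<^sub>0"
      using True by blast
    have L: "L \<in> {1..T} \<and> ?hit L"
      unfolding L_def by (rule LeastI[of "\<lambda>t. t \<in> {1..T} \<and> ?hit t", OF t0])
    have before: "\<not> ?hit j" if "j \<in> {1..T}" "j < L" for j
      using not_less_Least[of j "\<lambda>t. t \<in> {1..T} \<and> ?hit t"] that unfolding L_def by blast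
    have "(\<forall>j\<in>{1..t-1}. \<not> ?hit j) \<longleftrightarrow> t \<le> L" if t: "t \<in> {1..T}" for t
    proof
      show "t \<le> L" if "\<forall>j\<in>{1..t-1}. \<not> ?hit j"
      proof (rule ccontr)
        assume "\<not> t \<le> L"
        then have "L \<in> {1..t-1}" using L by simp
        then show False using that L by blast
      qed
    next
      assume le: "t \<le> L"
      show "\<forall>j\<in>{1..t-1}. \<not> ?hit j"
      proof
        fix j assume "j \<in> {1..t-1}"
        then have "j \<in> {1..T}" "j < L" using t le by auto
        then show "\<not> ?hit j" by (rule before)
      qed
    qed
    with L show ?thesis
      unfolding n by blast
  next
    case False
    then show ?thesis
      using assms by (auto simp: num_tests_def)
  qed
  then have n: "?n \<in> {1..T}" and hit: "\<And>t. t \<in> {1..T} \<Longrightarrow>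
      (\<lambda>j. candidate q N \<pi> e j y) ` {1..t-1} \<inter> C = {} \<longleftrightarrow> t \<le> ?n"
    by blast+
  have "(\<Sum>t=1..T. of_bool ((\<lambda>j. candidate q N \<pi> e j y) ` {1..t-1} \<inter> C = {})) =
      (\<Sum>t=1..T. of_bool (t \<le> ?n) :: real)"
    using hit by (intro sum.cong refl) (simp only:)
  also have "\<dots> = (\<Sum>t=1..?n. 1)"
    using n by (intro sum.mono_neutral_cong_right) auto
  finally show ?thesis by simp
qed

text \<open>Summation by parts, done by induction on \<open>T\<close>: passing from \<open>T\<close>
  to \<open>Suc T\<close> adds \<open>1 - f (Suc T)\<close> to the coefficient of every
  \<open>p t\<close>.\<close>

lemma sum_survival_products:
  fixes f p :: "nat \<Rightarrow> real"
  assumes "1 \<le> T"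
  shows "(\<Sum>t=1..T. (1 - f t) * (1 - (\<Sum>j=1..t-1. p j))) =
    real T - (\<Sum>t=1..T. f t) - (\<Sum>t=1..T-1. p t * (real T - real t - (\<Sum>i=t+1..T. f i)))"
  using assms
proof (induction T rule: nat_induct_at_least)
  case base
  then show ?case by simp
next
  case (Suc T)
  have "(\<Sum>t=1..T. p t * (real (Suc T) - real t - (\<Sum>i=t+1..Suc T. f i))) =
      (\<Sum>t=1..T. p t * (real T - real t - (\<Sum>i=t+1..T. f i)) + p t * (1 - f (Suc T)))"
    by (intro sum.cong) (auto simp: algebra_simps)
  also have "\<dots> = (\<Sum>t=1..T. p t * (real T - real t - (\<Sum>i=t+1..T. f i))) +
      (\<Sum>t=1..T. p t) * (1 - f (Suc T))"
    by (simp add: sum.distrib sum_distrib_right)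
  \<comment> \<open>The summand at \<open>t = T\<close> vanishes: its bracket is
    \<open>T - T\<close> minus an empty sum.\<close>
  also have "(\<Sum>t=1..T. p t * (real T - real t - (\<Sum>i=t+1..T. f i))) =
      (\<Sum>t=1..T-1. p t * (real T - real t - (\<Sum>i=t+1..T. f i)))"
    using Suc.hyps by (cases T) auto
  finally have eq: "(\<Sum>t=1..T. p t * (real (Suc T) - real t - (\<Sum>i=t+1..Suc T. f i))) =
      (\<Sum>t=1..T-1. p t * (real T - real t - (\<Sum>i=t+1..T. f i))) + (\<Sum>t=1..T. p t) * (1 - f (Suc T))" .
  have survival: "(\<Sum>t=1..Suc T. (1 - f t) * (1 - (\<Sum>j=1..t-1. p j))) =
      (\<Sum>t=1..T. (1 - f t) * (1 - (\<Sum>j=1..t-1. p j))) + (1 - f (Suc T)) * (1 - (\<Sum>t=1..T. p t))"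
    by simp
  have f: "(\<Sum>t=1..Suc T. f t) = (\<Sum>t=1..T. f t) + f (Suc T)"
    by simp
  have "r - a - b + (1 - x) * (1 - y) = 1 + r - (a + x) - (b + y * (1 - x))" for r a b x y :: real
    by (simp add: algebra_simps)
  then show ?case
    unfolding diff_Suc_1 eq survival f Suc.IH unfolding of_nat_Suc .
qed

subsection \<open>The random code ensemble\<close>

(* Otherwise the simplifier turns {1..N} inside "outputs N" into {Suc 0..N}. *)
declare One_nat_def [simp del]

text \<open>This makes the set of words tested so far a random variable. Elements are inserted one
  at a time, with a case split over the finitely many values of the new one.\<close>

lemma measurable_image_count_space:
  fixes s :: nat
  assumes "\<And>j. j \<le> s \<Longrightarrow> f j \<in> measurable M (count_space I)" "finite I"
  shows "(\<lambda>y. (\<lambda>j. f j y) ` {1..s}) \<in> measurable M (count_space (Pow I))"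
  using assms(1)
proof (induction s)
  case 0
  then show ?case by simp
next
  case (Suc s)
  have "(\<lambda>y. insert (f (Suc s) y) ((\<lambda>j. f j y) ` {1..s})) \<in> measurable M (count_space (Pow I))"
  proof (rule measurable_compose_countable'[where g = "f (Suc s)" and I = I])
    show "(\<lambda>y. insert w ((\<lambda>j. f j y) ` {1..s})) \<in> measurable M (count_space (Pow I))"
      if "w \<in> I" for w
      using that Suc by (intro measurable_compose[OF Suc.IH]) auto
  qed (use Suc.prems assms(2) in \<open>auto simp: countable_finite\<close>)
  then show ?case
    by (simp add: atLeastAtMostSuc_conv)
qed

lemma add_word_in_words: "add_word N u v \<in> words N"
  by (simp add: add_word_def words_def)

lemma is_density_bit: "is_density (q 0) \<Longrightarrow> is_density (q 1) \<Longrightarrow> is_density (q (b :: bit))"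
  by (cases b) simp_all

section \<open>The channel and the ensemble as probability measures\<close>

lemma sets_channel [simp]: "sets (channel q N w) = sets (outputs N)"
  unfolding channel_def sets_density by (intro sets_PiM_cong) simp_all

lemma space_channel [simp]: "space (channel q N w) = space (outputs N)"
  by (rule sets_eq_imp_space_eq) simp

lemma measurable_channel [simp]: "measurable (channel q N w) M = measurable (outputs N) M"
  by (rule measurable_cong_sets) simp_all

locale binary_input_channel =
  fixes q :: "bit \<Rightarrow> real \<Rightarrow> real"
  assumes is_density_q: "is_density (q b)"
begin

lemma measurable_q [measurable]: "q b \<in> borel_measurable borel"
  using is_density_q[of b] by (simp add: is_density_def)

lemma q_nonneg: "0 \<le> q b x"
  using is_density_q[of b] by (simp add: is_density_def)

lemma prob_space_channel: "prob_space (channel q N w)"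
proof
  interpret product_sigma_finite "\<lambda>_ :: nat. lborel :: real measure"
    by unfold_locales
  have "emeasure (channel q N w) (space (channel q N w)) =
      (\<integral>\<^sup>+ y. ennreal (\<Prod>i\<in>{1..N}. q (w i) (y i)) \<partial>PiM {1..N} (\<lambda>_. lborel))"
    unfolding channel_def by (subst emeasure_density) (auto intro!: nn_integral_cong)
  also have "\<dots> = (\<integral>\<^sup>+ y. (\<Prod>i\<in>{1..N}. ennreal (q (w i) (y i))) \<partial>PiM {1..N} (\<lambda>_. lborel))"
    by (simp add: prod_ennreal q_nonneg)
  also have "\<dots> = (\<Prod>i\<in>{1..N}. \<integral>\<^sup>+ x. ennreal (q (w i) x) \<partial>lborel)"
    by (rule product_nn_integral_prod) simp_all
  also have "\<dots> = 1"
    using is_density_q by (simp add: is_density_def)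
  finally show "emeasure (channel q N w) (space (channel q N w)) = 1" .
qed

text \<open>The source is discrete, so it suffices that every value is a probability
  measure.\<close>

lemma channel_kernel:
  "(\<lambda>c. distr (channel q N (f c)) (count_space UNIV \<Otimes>\<^sub>M outputs N) (\<lambda>y. (c, y)))
    \<in> measurable (measure_pmf p) (subprob_algebra (count_space UNIV \<Otimes>\<^sub>M outputs N))"
proof -
  have "prob_space (distr (channel q N (f c)) (count_space UNIV \<Otimes>\<^sub>M outputs N) (\<lambda>y. (c, y)))" for c
    by (intro prob_space.prob_space_distr prob_space_channel) simp
  then show ?thesis
    by (auto simp: space_subprob_algebra prob_space_imp_subprob_space)
qed

lemma sets_ensemble [simp, measurable_cong]:
  "sets (ensemble q N K) = sets (count_space UNIV \<Otimes>\<^sub>M outputs N)"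
  unfolding ensemble_def by (rule sets_bind) simp_all

lemma space_ensemble [simp]: "space (ensemble q N K) = space (count_space UNIV \<Otimes>\<^sub>M outputs N)"
  by (rule sets_eq_imp_space_eq) simp

lemma prob_space_ensemble: "prob_space (ensemble q N K)"
  unfolding ensemble_def
  by (intro measure_pmf.prob_space_bind[OF _ channel_kernel] AE_I2
      prob_space.prob_space_distr prob_space_channel) simp

lemma measurable_received [measurable]: "received \<in> measurable (ensemble q N K) (outputs N)"
  unfolding received_def by measurable

lemma measurable_sent [measurable]: "sent \<in> measurable (ensemble q N K) (count_space UNIV)"
proof -
  have "(\<lambda>\<omega>. (\<lambda>c. fst c ! snd c) (fst \<omega>)) \<in> measurable (ensemble q N K) (count_space UNIV)"
    by (rule measurable_compose[where N = "count_space UNIV"]) simp_all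
  then show ?thesis
    by (simp add: sent_def[abs_def])
qed

section \<open>Probabilities of ensemble events\<close>

lemma measure_ensemble:
  assumes "A \<in> sets (count_space UNIV \<Otimes>\<^sub>M outputs N)"
  shows "measure (ensemble q N K) A =
    (\<integral>c. measure (channel q N (fst c ! snd c)) {y \<in> space (outputs N). (c, y) \<in> A}
      \<partial>pair_pmf (draw_codewords N (2 ^ K)) (pmf_of_set {..<2 ^ K}))"
proof -
  have "measure (distr (channel q N w) (count_space UNIV \<Otimes>\<^sub>M outputs N) (Pair c)) A =
      measure (channel q N w) {y \<in> space (outputs N). (c, y) \<in> A}" for c w
    using assms sets.sets_into_space[OF assms]
    by (subst measure_distr) (auto intro!: arg_cong2[where f = measure] simp: space_pair_measure)
  then show ?thesis
    unfolding ensemble_def by (subst measure_pmf.measure_bind[OF channel_kernel assms]) simp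
qed

text \<open>\<open>R\<close> may be arbitrary: for each of the finitely many values of
  \<open>S\<close> the condition concerns only the discrete component of the outcome.\<close>

lemma sets_ensemble_event:
  assumes S: "S \<in> measurable (outputs N) (count_space I)" and "finite I"
  shows "{\<omega> \<in> space (ensemble q N K). R (fst \<omega>) (S (received \<omega>))} \<in>
    sets (count_space UNIV \<Otimes>\<^sub>M outputs N)"
proof -
  have "(\<lambda>\<omega>. R (fst \<omega>) (S (received \<omega>))) \<in> measurable (ensemble q N K) (count_space UNIV)"
  proof (rule measurable_compose_countable'[where I = I])
    show "(\<lambda>\<omega>. R (fst \<omega>) A) \<in> measurable (ensemble q N K) (count_space UNIV)" for A
      by (rule measurable_compose[where N = "count_space UNIV"]) simp_all
    show "(\<lambda>\<omega>. S (received \<omega>)) \<in> measurable (ensemble q N K) (count_space I)"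
      by (rule measurable_compose[OF measurable_received S])
  qed (simp add: assms(2) countable_finite)
  then have "{\<omega> \<in> space (ensemble q N K). R (fst \<omega>) (S (received \<omega>))} \<in> sets (ensemble q N K)"
    by (simp add: pred_def)
  then show ?thesis
    unfolding sets_ensemble .
qed

text \<open>Splitting by the value \<open>A\<close> of \<open>S\<close> separates the condition on
  codebook and index from a weight that depends only on the sent word, which is the form treated by
  \<open>expectation_avoid\<close>.\<close>

lemma measure_ensemble_event:
  assumes S: "S \<in> measurable (outputs N) (count_space I)" and I: "finite I"
  shows "measure (ensemble q N K) {\<omega> \<in> space (ensemble q N K). R (fst \<omega>) (S (received \<omega>))} =
    (\<Sum>A\<in>I. \<integral>c. of_bool (R c A) *
        measure (channel q N (fst c ! snd c)) {y \<in> space (outputs N). S y = A}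
      \<partial>pair_pmf (draw_codewords N (2 ^ K)) (pmf_of_set {..<2 ^ K}))"
proof -
  have "measure (channel q N w) {y \<in> space (outputs N).
      (c, y) \<in> {\<omega> \<in> space (ensemble q N K). R (fst \<omega>) (S (received \<omega>))}} =
      (\<Sum>A\<in>I. of_bool (R c A) * measure (channel q N w) {y \<in> space (outputs N). S y = A})" for c w
  proof -
    interpret prob_space "channel q N w"
      by (rule prob_space_channel)
    have *: "{y \<in> space (outputs N). S y = A} \<in> sets (channel q N w)" if "A \<in> I" for A
      using measurable_sets[OF S, of "{A}"] that
      by (simp add: vimage_def Int_def conj_commute)
    have "{y \<in> space (outputs N). (c, y) \<in> {\<omega> \<in> space (ensemble q N K). R (fst \<omega>) (S (received \<omega>))}} =
        (\<Union>A\<in>{A\<in>I. R c A}. {y \<in> space (outputs N). S y = A})"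
      using measurable_space[OF S] by (auto simp: space_pair_measure received_def)
    moreover have "prob (\<Union>A\<in>{A\<in>I. R c A}. {y \<in> space (outputs N). S y = A}) =
        (\<Sum>A\<in>{A\<in>I. R c A}. prob {y \<in> space (outputs N). S y = A})"
      using I * by (intro finite_measure_finite_Union) (auto simp: disjoint_family_on_def)
    moreover have "\<dots> = (\<Sum>A\<in>I. of_bool (R c A) * prob {y \<in> space (outputs N). S y = A})"
      using I by (intro sum.mono_neutral_cong_left) auto
    ultimately show ?thesis
      by simp
  qed
  moreover have "integrable (measure_pmf p) (\<lambda>c. of_bool (R c A) *
      measure (channel q N (fst c ! snd c)) {y \<in> space (outputs N). S y = A})" for p A
    by (rule measure_pmf.integrable_const_bound[where B = 1])
      (simp_all add: prob_space.prob_le_1[OF prob_space_channel])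
  ultimately show ?thesis
    unfolding measure_ensemble[OF sets_ensemble_event[OF assms]]
    by simp
qed

lemma prob_avoid_codebook:
  assumes "K \<le> N" "s < 2 ^ N"
    and S: "S \<in> measurable (outputs N) (count_space (Pow (words N)))"
    and card: "\<And>y. y \<in> space (outputs N) \<Longrightarrow> card (S y) = s"
  shows "measure (ensemble q N K)
      {\<omega> \<in> space (ensemble q N K). S (received \<omega>) \<inter> codebook \<omega> = {}} =
    (1 - pre_target_hit N K (Suc s)) *
      measure (ensemble q N K) {\<omega> \<in> space (ensemble q N K). sent \<omega> \<notin> S (received \<omega>)}"
proof -
  let ?C = "pair_pmf (draw_codewords N (2 ^ K)) (pmf_of_set {..<2 ^ K})"
  let ?h = "\<lambda>A w. measure (channel q N w) {y \<in> space (outputs N). S y = A}"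
  have "(\<integral>c. of_bool (A \<inter> set (fst c) = {}) * ?h A (fst c ! snd c) \<partial>?C) =
      (1 - pre_target_hit N K (Suc s)) * (\<integral>c. of_bool (fst c ! snd c \<notin> A) * ?h A (fst c ! snd c) \<partial>?C)"
    if "A \<in> Pow (words N)" for A
  proof (cases "card A = s")
    case True
    then show ?thesis
      using expectation_avoid[of K N A "?h A"] assms(1,2) that by simp
  next
    case False
    \<comment> \<open>A set of the wrong size is never attained, so its weight is 0; hence one
      factor serves all \<open>A\<close> and can be pulled out of the sum.\<close>
    then have "{y \<in> space (outputs N). S y = A} = {}"
      using card by auto
    then show ?thesis
      unfolding \<open>_ = {}\<close> by simp
  qed
  then show ?thesis
    unfolding codebook_def sent_def
    using measure_ensemble_event[OF S, of K "\<lambda>c A. A \<inter> set (fst c) = {}"]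
      measure_ensemble_event[OF S, of K "\<lambda>c A. fst c ! snd c \<notin> A"]
    by (simp add: sum_distrib_left)
qed

text \<open>The posterior is a separate conditional expectation for each fixed word, whereas here
  the word is random. Since it is a function of the output with finitely many values, each indicator
  that it equals \<open>w\<close> is measurable for the output algebra and may multiply the
  conditional expectation under the integral.\<close>

lemma expectation_posterior:
  assumes C: "C \<in> measurable (outputs N) (count_space (words N))"
  shows "(\<integral>\<omega>. posterior q N K (C (received \<omega>)) \<omega> \<partial>ensemble q N K) =
    measure (ensemble q N K) {\<omega> \<in> space (ensemble q N K). sent \<omega> = C (received \<omega>)}"
proof -
  let ?M = "ensemble q N K" and ?F = "output_algebra q N K"
  interpret prob_space ?M
    by (rule prob_space_ensemble)
  have sub: "subalgebra ?M ?F"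
    unfolding subalgebra_def output_algebra_def
    using measurable_received[of N K, THEN measurable_sets]
      measurable_received[of N K, THEN measurable_space]
    by (auto simp: sets_vimage_algebra2)
  interpret finite_measure_subalgebra ?M ?F
    by unfold_locales (rule sub)
  have rec: "received \<in> measurable ?F (outputs N)"
    unfolding output_algebra_def
    by (rule measurable_vimage_algebra1) (use measurable_received[of N K, THEN measurable_space] in auto)
  have CF: "(\<lambda>\<omega>. C (received \<omega>)) \<in> measurable ?F (count_space (words N))"
    by (rule measurable_compose[OF rec C])
  have CM: "(\<lambda>\<omega>. C (received \<omega>)) \<in> measurable ?M (count_space (words N))"
    by (rule measurable_compose[OF measurable_received C])
  have iF: "(\<lambda>\<omega>. indicator {w} (C (received \<omega>)) :: real) \<in> borel_measurable ?F" for w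
    by (rule measurable_compose[OF CF]) simp
  have iM: "(\<lambda>\<omega>. indicator {w} (C (received \<omega>)) :: real) \<in> borel_measurable ?M" for w
    by (rule measurable_compose[OF CM]) simp
  have sM: "indicator {\<omega>. sent \<omega> = w} \<in> borel_measurable ?M" for w
  proof -
    have "(\<lambda>\<omega>. indicator {w} (sent \<omega>) :: real) \<in> borel_measurable ?M"
      by (rule measurable_compose[OF measurable_sent]) simp
    moreover have "(\<lambda>\<omega>. indicator {w} (sent \<omega>) :: real) = indicator {\<omega>. sent \<omega> = w}"
      by (auto simp: indicator_def)
    ultimately show ?thesis by simp
  qed
  have int: "integrable ?M (\<lambda>\<omega>. indicator {w} (C (received \<omega>)) * indicator {\<omega>. sent \<omega> = w} \<omega> :: real)" for w
    using iM sM by (intro integrable_const_bound[where B = 1]) (auto simp: indicator_def)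
  note cond = real_cond_exp_intg[OF int iF sM]
  \<comment> \<open>Exactly one summand survives, because \<open>C\<close> takes its values in
    \<open>words N\<close>.\<close>
  have collapse: "(\<Sum>w\<in>words N. indicator {w} (C (received \<omega>)) * f w) = f (C (received \<omega>))"
    if "\<omega> \<in> space ?M" for \<omega> and f :: "(nat \<Rightarrow> bit) \<Rightarrow> real"
    using measurable_space[OF CM that] by (subst sum.remove) (auto intro!: sum.neutral)
  have ev: "{\<omega> \<in> space ?M. sent \<omega> = C (received \<omega>)} \<in> sets ?M"
    using sets_ensemble_event[OF C, of K "\<lambda>c w. fst c ! snd c = w"] by (simp add: sent_def)
  have "(\<integral>\<omega>. posterior q N K (C (received \<omega>)) \<omega> \<partial>?M) =
      (\<integral>\<omega>. (\<Sum>w\<in>words N. indicator {w} (C (received \<omega>)) * posterior q N K w \<omega>) \<partial>?M)"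
    by (intro Bochner_Integration.integral_cong refl) (rule collapse[symmetric])
  also have "\<dots> = (\<Sum>w\<in>words N. \<integral>\<omega>. indicator {w} (C (received \<omega>)) * posterior q N K w \<omega> \<partial>?M)"
    unfolding posterior_def using cond(1) by (rule Bochner_Integration.integral_sum)
  also have "\<dots> = (\<Sum>w\<in>words N. \<integral>\<omega>. indicator {w} (C (received \<omega>)) * indicator {\<omega>. sent \<omega> = w} \<omega> \<partial>?M)"
    unfolding posterior_def cond(2) ..
  also have "\<dots> = (\<integral>\<omega>. (\<Sum>w\<in>words N. indicator {w} (C (received \<omega>)) * indicator {\<omega>. sent \<omega> = w} \<omega>) \<partial>?M)"
    by (rule Bochner_Integration.integral_sum[symmetric]) (rule int)
  also have "\<dots> = (\<integral>\<omega>. indicator {\<omega> \<in> space ?M. sent \<omega> = C (received \<omega>)} \<omega> \<partial>?M)"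
    by (intro Bochner_Integration.integral_cong refl)
      (simp only: collapse, auto simp: indicator_def)
  also have "\<dots> = prob {\<omega> \<in> space ?M. sent \<omega> = C (received \<omega>)}"
    using ev by simp
  finally show ?thesis .
qed

section \<open>Measurability and injectivity of the candidate words\<close>

lemma measurable_hard_decision:
  "hard_decision q N \<in> measurable (outputs N) (count_space (words N))"
proof -
  have llr: "Measurable.pred borel (\<lambda>x. llr q x < 0)"
    unfolding llr_def by measurable
  have "hard_decision q N -` {w} \<inter> space (outputs N) \<in> sets (outputs N)" if "w \<in> words N" for w
  proof -
    \<comment> \<open>A bit is determined by whether it is 1, so equality of words becomes a
      coordinatewise condition on the sign of the log-likelihood ratio.\<close>
    have bit: "(llr q x < 0) = (b = 1) \<longleftrightarrow> (if llr q x < 0 then 1 else 0) = b" for x and b :: bit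
      by (cases b) auto
    have "hard_decision q N y = w \<longleftrightarrow> (\<forall>i\<in>{1..N}. (llr q (y i) < 0) = (w i = 1))" for y
      using that unfolding bit
      by (auto simp: hard_decision_def words_def fun_eq_iff PiE_def extensional_def)
    then have "hard_decision q N -` {w} \<inter> space (outputs N) =
        {y \<in> space (outputs N). \<forall>i\<in>{1..N}. (llr q (y i) < 0) = (w i = 1)}"
      by auto
    also have "\<dots> \<in> sets (outputs N)"
      using llr by measurable
    finally show ?thesis .
  qed
  moreover have "hard_decision q N y \<in> words N" for y
    by (simp add: hard_decision_def words_def)
  ultimately show ?thesis
    by (simp add: measurable_count_space_eq2)
qed

text \<open>There are finitely many permutations, and for a fixed one the candidate is a function of
  the hard decision.\<close>

lemma measurable_candidate:
  assumes "\<pi> \<in> measurable (outputs N) (count_space {\<sigma>. \<sigma> permutes {1..N}})"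
  shows "candidate q N \<pi> e t \<in> measurable (outputs N) (count_space (words N))"
  unfolding candidate_def[abs_def]
proof (rule measurable_compose_countable'[OF _ assms])
  show "(\<lambda>y. add_word N (hard_decision q N y) (permute_word N \<sigma> (e t)))
      \<in> measurable (outputs N) (count_space (words N))" for \<sigma>
    by (rule measurable_compose[OF measurable_hard_decision]) (simp add: add_word_in_words)
qed (simp add: countable_finite finite_permutations)

text \<open>For a fixed output, both permuting coordinates and adding the hard decision can be
  undone.\<close>

lemma inj_on_candidate:
  assumes "\<pi> y permutes {1..N}" "e ` A \<subseteq> words N" "inj_on e A"
  shows "inj_on (\<lambda>t. candidate q N \<pi> e t y) A"
proof (rule inj_onI)
  fix s t assume st: "s \<in> A" "t \<in> A" "candidate q N \<pi> e s y = candidate q N \<pi> e t y"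
  have "e s i = e t i" for i
  proof (cases "i \<in> {1..N}")
    case True
    then obtain j where j: "j \<in> {1..N}" "i = \<pi> y j"
      using permutes_image[OF assms(1)] by blast
    then show ?thesis
      using fun_cong[OF st(3), of j]
      by (simp only: candidate_def add_word_def permute_word_def restrict_apply' add_left_cancel)
  next
    \<comment> \<open>Outside \<open>{1..N}\<close> all words take the value
      \<open>undefined\<close>.\<close>
    case False
    moreover have "e s \<in> words N" "e t \<in> words N"
      using assms(2) st(1,2) by auto
    ultimately show ?thesis
      by (metis PiE_arb words_def)
  qed
  then have "e s = e t"
    by (rule ext)
  then show "s = t"
    using inj_onD[OF assms(3)] st(1,2) by blast
qed

section \<open>Survival probabilities\<close>

lemma prob_sent_not_tested:
  assumes \<pi>: "\<pi> \<in> measurable (outputs N) (count_space {\<sigma>. \<sigma> permutes {1..N}})"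
    and e: "e ` {1..s} \<subseteq> words N" "inj_on e {1..s}"
  shows "measure (ensemble q N K) {\<omega> \<in> space (ensemble q N K).
      sent \<omega> \<notin> (\<lambda>j. candidate q N \<pi> e j (received \<omega>)) ` {1..s}} =
    1 - (\<Sum>j=1..s. p_hit q N K \<pi> e j)"
proof -
  let ?M = "ensemble q N K"
  interpret prob_space ?M
    by (rule prob_space_ensemble)
  let ?H = "\<lambda>j. {\<omega> \<in> space ?M. sent \<omega> = candidate q N \<pi> e j (received \<omega>)}"
  have H: "?H j \<in> sets ?M" for j
    using sets_ensemble_event[OF measurable_candidate[OF \<pi>], of K "\<lambda>c w. fst c ! snd c = w"]
    by (simp add: sent_def)
  have "disjoint_family_on ?H {1..s}"
    unfolding disjoint_family_on_def
  proof (intro ballI impI)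
    fix i j assume ij: "i \<in> {1..s}" "j \<in> {1..s}" "i \<noteq> j"
    have "candidate q N \<pi> e i (received \<omega>) \<noteq> candidate q N \<pi> e j (received \<omega>)"
      if "\<omega> \<in> space ?M" for \<omega>
    proof -
      have "\<pi> (received \<omega>) permutes {1..N}"
        using measurable_space[OF \<pi> measurable_space[OF measurable_received that]] by simp
      then show ?thesis
        using inj_onD[OF inj_on_candidate[OF _ e], of \<pi> "received \<omega>" i j] ij by blast
    qed
    then show "?H i \<inter> ?H j = {}" by fastforce
  qed
  then have "prob (\<Union>j\<in>{1..s}. ?H j) = (\<Sum>j=1..s. p_hit q N K \<pi> e j)"
    unfolding p_hit_def expectation_posterior[OF measurable_candidate[OF \<pi>]]
    using H by (intro finite_measure_finite_Union) auto
  moreover have "{\<omega> \<in> space ?M. sent \<omega> \<notin> (\<lambda>j. candidate q N \<pi> e j (received \<omega>)) ` {1..s}} =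
      space ?M - (\<Union>j\<in>{1..s}. ?H j)"
    by auto
  moreover have "(\<Union>j\<in>{1..s}. ?H j) \<in> events"
    using H by blast
  ultimately show ?thesis
    by (simp only: prob_compl)
qed

text \<open>The set of the first \<open>s\<close> candidates is a function of the output and has
  exactly \<open>s\<close> elements by injectivity, so \<open>prob_avoid_codebook\<close> applies to
  it; the remaining event is that the sent word was not tested.\<close>

lemma prob_no_early_hit:
  assumes "K \<le> N" "s < 2 ^ N"
    and \<pi>: "\<pi> \<in> measurable (outputs N) (count_space {\<sigma>. \<sigma> permutes {1..N}})"
    and e: "e ` {1..s} \<subseteq> words N" "inj_on e {1..s}"
  shows "measure (ensemble q N K) {\<omega> \<in> space (ensemble q N K).
      (\<lambda>j. candidate q N \<pi> e j (received \<omega>)) ` {1..s} \<inter> codebook \<omega> = {}} =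
    (1 - pre_target_hit N K (Suc s)) * (1 - (\<Sum>j=1..s. p_hit q N K \<pi> e j))"
proof -
  have "card ((\<lambda>j. candidate q N \<pi> e j y) ` {1..s}) = s" if "y \<in> space (outputs N)" for y
    using measurable_space[OF \<pi> that] e by (simp add: card_image inj_on_candidate)
  then show ?thesis
    unfolding prob_sent_not_tested[OF \<pi> e, symmetric]
    by (intro prob_avoid_codebook assms(1,2) measurable_image_count_space
        measurable_candidate[OF \<pi>] finite_words)
qed

end

theorem theorem2:
  fixes N K T :: nat
    and q :: "bit \<Rightarrow> real \<Rightarrow> real"
    and \<pi> :: "(nat \<Rightarrow> real) \<Rightarrow> nat \<Rightarrow> nat"
    and e :: "nat \<Rightarrow> nat \<Rightarrow> bit"
  assumes "K \<le> N"
    and "1 \<le> T" and "T \<le> 2 ^ N"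
    and "is_density (q 0)" and "is_density (q 1)"
    and "e ` {1..T} \<subseteq> words N" and "inj_on e {1..T}"
    and "\<pi> \<in> measurable (outputs N) (count_space {\<sigma>. \<sigma> permutes {1..N}})"
  shows "avg_tests q N K T \<pi> e =
    real T - (\<Sum>t=1..T. pre_target_hit N K t)
      - (\<Sum>t=1..T-1. p_hit q N K \<pi> e t
           * (real T - real t - (\<Sum>i=t+1..T. pre_target_hit N K i)))"
proof -
  interpret binary_input_channel q
    by unfold_locales (rule is_density_bit[OF assms(4,5)])
  let ?M = "ensemble q N K"
  interpret prob_space ?M
    by (rule prob_space_ensemble)
  \<comment> \<open>\<open>?E s\<close> says that the first \<open>s\<close> tests find no codeword;
    reaching test \<open>t\<close> is \<open>?E (t - 1)\<close>.\<close>
  let ?E = "\<lambda>s. {\<omega> \<in> space ?M.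
      (\<lambda>j. candidate q N \<pi> e j (received \<omega>)) ` {1..s} \<inter> codebook \<omega> = {}}"
  have E: "?E s \<in> sets ?M" for s
    using sets_ensemble_event[OF measurable_image_count_space[of s "candidate q N \<pi> e"
          "outputs N" "words N"], of K "\<lambda>c A. A \<inter> set (fst c) = {}"]
      measurable_candidate[OF assms(8)] by (simp add: codebook_def)
  have "avg_tests q N K T \<pi> e = (\<integral>\<omega>. (\<Sum>t=1..T. indicator (?E (t - 1)) \<omega>) \<partial>?M)"
    unfolding avg_tests_def num_tests_eq_sum[OF assms(2)]
    by (intro Bochner_Integration.integral_cong sum.cong refl) (simp add: indicator_def)
  also have "\<dots> = (\<Sum>t=1..T. \<integral>\<omega>. indicator (?E (t - 1)) \<omega> \<partial>?M)"
    using E by (intro Bochner_Integration.integral_sum) (simp add: less_top[symmetric])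
  also have "\<dots> = (\<Sum>t=1..T. prob (?E (t - 1)))"
    using E by simp
  also have "\<dots> = (\<Sum>t=1..T. (1 - pre_target_hit N K t) * (1 - (\<Sum>j=1..t-1. p_hit q N K \<pi> e j)))"
  proof (intro sum.cong refl)
    fix t assume t: "t \<in> {1..T}"
    then have "{1..t - 1} \<subseteq> {1..T}"
      by auto
    then have "e ` {1..t - 1} \<subseteq> words N" "inj_on e {1..t - 1}"
      using assms(6) inj_on_subset[OF assms(7)] by blast+
    \<comment> \<open>The bound on \<open>T\<close> enters here: before test \<open>t\<close> some
      word is still untested.\<close>
    moreover have "t - 1 < 2 ^ N" "Suc (t - 1) = t"
      using t assms(3) by auto
    ultimately show "prob (?E (t - 1)) =
        (1 - pre_target_hit N K t) * (1 - (\<Sum>j=1..t-1. p_hit q N K \<pi> e j))"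
      using prob_no_early_hit[OF assms(1) _ assms(8), of "t - 1" e] by simp
  qed
  also have "\<dots> = real T - (\<Sum>t=1..T. pre_target_hit N K t)
      - (\<Sum>t=1..T-1. p_hit q N K \<pi> e t
           * (real T - real t - (\<Sum>i=t+1..T. pre_target_hit N K i)))"
    by (rule sum_survival_products[OF assms(2)])
  finally show ?thesis .
qed

end
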